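(* Let $X$ be a non-empty set. There are bijections $$\phi_{\mathcal{M},\mathcal{P}}:\mathcal{M}(X)\to\mathcal{P}(X),\quad \phi_{\mathcal{S},\mathcal{L}}:\mathcal{S}(X)\to\mathcal{L}(X),\quad \phi_{\mathcal{R},\mathcal{V}}:\mathcal{R}(X)\to\mathcal{V}(X),$$ $$\phi_{\mathcal{L},\mathcal{F}}:\mathcal{L}(X)\to\mathcal{F}(X),\quad \phi_{\mathcal{V},X^{\mathcal{F}}}:\mathcal{V}(X)\to X^{\mathcal{F}},\quad \phi_{\mathcal{S}\mathcal{R},\mathcal{L}\mathcal{V}}:\mathcal{S}(X)\cap\mathcal{R}(X)\to\mathcal{L}(X)\cap\mathcal{V}(X),$$ $$\phi_{\mathcal{L}\mathcal{V},\mathcal{F}_\ell}:\mathcal{L}(X)\cap\mathcal{V}(X)\to\mathcal{F}_\ell(X),\quad \phi_{\mathcal{L}\mathcal{V},X_0^{\mathcal{F}}}:\mathcal{L}(X)\cap\mathcal{V}(X)\to X_0^{\mathcal{F}},\quad \phi_{\mathcal{F}_\ell,X_0^{\mathcal{F}}}:\mathcal{F}_\ell(X)\to X_0^{\mathcal{F}},$$ which, together with the inclusions $\mathcal{S}(X)\hookrightarrow\mathcal{M}(X)$, $\mathcal{R}(X)\hookrightarrow\mathcal{M}(X)$, $\mathcal{L}(X)\hookrightarrow\mathcal{P}(X)$, $\mathcal{V}(X)\hookrightarrow\mathcal{P}(X)$, $\mathcal{S}(X)\cap\mathcal{R}(X)\hookrightarrow\mathcal{S}(X)$, $\mathcal{S}(X)\cap\mathcal{R}(X)\hookrightarrow\mathcal{R}(X)$,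 $\mathcal{L}(X)\cap\mathcal{V}(X)\hookrightarrow\mathcal{L}(X)$, $\mathcal{L}(X)\cap\mathcal{V}(X)\hookrightarrow\mathcal{V}(X)$, $\mathcal{F}_\ell(X)\hookrightarrow\mathcal{F}(X)$, $X_0^{\mathcal{F}}\hookrightarrow X^{\mathcal{F}}$, form a commutative diagram. That is: (i) $\phi_{\mathcal{S},\mathcal{L}}$ and $\phi_{\mathcal{R},\mathcal{V}}$ are restrictions of $\phi_{\mathcal{M},\mathcal{P}}$; (ii) $\phi_{\mathcal{S}\mathcal{R},\mathcal{L}\mathcal{V}}$ is the restriction of both $\phi_{\mathcal{S},\mathcal{L}}$ and $\phi_{\mathcal{R},\mathcal{V}}$; (iii) $\phi_{\mathcal{L}\mathcal{V},\mathcal{F}_\ell}$ is the restriction of $\phi_{\mathcal{L},\mathcal{F}}$; (iv) $\phi_{\mathcal{L}\mathcal{V},X_0^{\mathcal{F}}}$ is the restriction of $\phi_{\mathcal{V},X^{\mathcal{F}}}$; (v) $\phi_{\mathcal{F}_\ell,X_0^{\mathcal{F}}}\circ\phi_{\mathcal{L}\mathcal{V},\mathcal{F}_\ell}=\phi_{\mathcal{L}\mathcal{V},X_0^{\mathcal{F}}}$; and the squares consisting only of inclusions commute. Each of the maps is compatible with the products, whenever defined, and is compatible with the distinguished operators.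
   Context: **Bracketed words.** For a set $Y$, let $S(Y)$, $M(Y)$ be the free semigroup and the free monoid on $Y$, and let $\lfloor Y\rfloor=\{\lfloor y\rfloor\mid y\in Y\}$ be formal symbols in bijection with $Y$, disjoint from $Y$. Put $\mathcal{S}_0=S(X)$, $\mathcal{M}_0=M(X)$, and for $n\ge1$ $\mathcal{S}_n=S(X\cup\lfloor\mathcal{S}_{n-1}\rfloor)$, $\mathcal{M}_n=M(X\cup\lfloor\mathcal{M}_{n-1}\rfloor)$, with natural inclusions. $\mathcal{S}(X)=\bigcup_n\mathcal{S}_n\subseteq\mathcal{M}(X)=\bigcup_n\mathcal{M}_n$, with concatenation product and distinguished operator $W\mapsto\lfloor W\rfloor$. $\mathcal{R}(X)\subseteq\mathcal{M}(X)$ is the set of Rota–Baxter bracketed words: those not containing $\rfloor\lfloor$, i.e. at no nesting level do two bracketed factors $\lfloor W_1\rfloor\lfloor W_2\rfloor$ occur adjacently. **Motzkin paths.** A Motzkin path is a lattice path in $\mathbb{N}^2$ (with $\mathbb{N}$ the non-negative integers) from $(0,0)$ to some $(n,0)$, $n\ge0$, with steps $(1,1)$ (up), $(1,-1)$ (down), $(1,0)$ (level). $\mathcal{P}(X)$ is the set of Motzkin paths with level steps decorated by $X$; the product is the link product (joining paths end to end) and the distinguished operator is the raising operator $\mathfrak{m}\mapsto/\,\mathfrak{m}\,\backslash$ (add an up step at the left end and a down step at the right end). $\mathcal{L}(X)\subseteq\mathcal{P}(X)$: peak-free paths, i.e. those different from the trivial one-point path and with no up step immediately followed by a down step. $\mathcal{V}(X)\subseteq\mathcal{P}(X)$: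 valley-free paths, i.e. those with no down step immediately followed by an up step (the trivial path is included). **Leaf decorated forests.** A planar rooted tree is a finite rooted tree with a fixed planar embedding; a planar rooted forest is a concatenation $T_1\cdots T_b$, $b\ge1$, of such trees; $\mathcal{F}$ is the set of planar rooted forests. $\mathcal{F}(X)$ is the set of planar rooted forests with leaf vertices decorated by $X$ (the vertex of the one-vertex tree $\bullet$ is a leaf), with concatenation product and distinguished operator the grafting $\lfloor T_1\cdots T_b\rfloor$ (add a new root joined to the roots of $T_1,\dots,T_b$). The branches of a vertex are the subtrees rooted at its children; a branch is a leaf branch if it consists of a single vertex, and non-leaf otherwise. $\mathcal{F}_\ell(X)\subseteq\mathcal{F}(X)$ is the set of leaf-spaced forests: the leaf decorated forests that do not have a vertex with adjacent non-leaf branches. **Angularly decorated forests.** For $F\in\mathcal{F}$ with $\ell(F)$ leaves, $X^F$ is the set of pairs $(F;\vec x)$ with $\vec x\in X^{\ell(F)-1}$ (a single element, written $(F;\mathbf{1})$, if $\ell(F)=1$); $X^{\mathcal{F}}=\bigsqcup_{F\in\mathcal{F}}X^F$. Its distinguished operator is $\lfloor(F;\vec x)\rfloor=(\lfloor F\rfloor;\vec x)$. $X^{\mathcal{F}}$ is not closed under concatenation of forests and carries no product here. $X_0^{\mathcal{F}}\subseteq X^{\mathcal{F}}$ is the set of ladder-free forests: the $(F;\vec x)$ with $F\ne\bullet$ and such that no vertex of $F$, together with all its descendants, forms the two-vertex tree $\lfloor\bullet\rfloor$. **Compatibility.** The products are concatenation of words on $\mathcal{M}(X)$ and its subsets, the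 link product on $\mathcal{P}(X)$ and its subsets, and concatenation of forests on $\mathcal{F}(X)$ and its subset $\mathcal{F}_\ell(X)$; on a subset, the product of two elements is regarded as defined only when it lies in that subset. The distinguished operators on the subsets are those of the ambient sets: bracketing for words, raising for paths, grafting for forests. Compatibility of a map with products (resp. distinguished operators) means that it takes a product of elements to the product of their images (resp. the operator applied to an element to the operator applied to its image).
   Formalization: Leaf-spaced forests are also required to have no two adjacent non-leaf trees at top level (the trees count as branches of a virtual root); with the literal definition F_ℓ(X) is not closed under grafting and (iii) fails, e.g. for the forest of two grafted leaves. *)

theory Defs
  imports Main
begin

text \<open>
  Throughout, the decorations come from a set \<open>X\<close> of elements of an arbitrary type. All the
  subsets of the diagram are sets in the type of the ambient set, so that inclusions are
  identity maps.
\<close>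

section \<open>Bracketed words\<close>

text \<open>A word is a list of letters; \<open>Br w\<close> is the formal symbol attached to the word \<open>w\<close>.\<close>

datatype 'x letter = Var 'x | Br "'x letter list"

type_synonym 'x word = "'x letter list"

definition free_monoid :: "'y set \<Rightarrow> 'y list set" where
  "free_monoid Y = lists Y"

definition free_semigroup :: "'y set \<Rightarrow> 'y list set" where
  "free_semigroup Y = lists Y - {[]}"

primrec S_level :: "'x set \<Rightarrow> nat \<Rightarrow> 'x word set" where
  "S_level X 0 = free_semigroup (Var ` X)"
| "S_level X (Suc n) = free_semigroup (Var ` X \<union> Br ` S_level X n)"

primrec M_level :: "'x set \<Rightarrow> nat \<Rightarrow> 'x word set" where
  "M_level X 0 = free_monoid (Var ` X)"
| "M_level X (Suc n) = free_monoid (Var ` X \<union> Br ` M_level X n)"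

definition S_words :: "'x set \<Rightarrow> 'x word set" where
  "S_words X = (\<Union>n. S_level X n)"

definition M_words :: "'x set \<Rightarrow> 'x word set" where
  "M_words X = (\<Union>n. M_level X n)"

definition bracket :: "'x word \<Rightarrow> 'x word" where
  "bracket w = [Br w]"

text \<open>Two bracketed factors are adjacent, at some nesting level.\<close>

inductive has_adjacent_brackets :: "'x word \<Rightarrow> bool" where
  here: "has_adjacent_brackets (u @ [Br w1, Br w2] @ v)"
| inside: "has_adjacent_brackets w \<Longrightarrow> has_adjacent_brackets (u @ [Br w] @ v)"

definition R_words :: "'x set \<Rightarrow> 'x word set" where
  "R_words X = {w \<in> M_words X. \<not> has_adjacent_brackets w}"


section \<open>Motzkin paths\<close>

datatype 'x step = Up | Down | Level 'x

type_synonym 'x path = "'x step list"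

primrec rise :: "'x step \<Rightarrow> int" where
  "rise Up = 1"
| "rise Down = - 1"
| "rise (Level x) = 0"

definition height :: "'x path \<Rightarrow> int" where
  "height p = sum_list (map rise p)"

text \<open>
  A path is given by its steps, starting at \<open>(0,0)\<close>. Every step moves one unit to the right, so
  the point reached after \<open>k\<close> steps is \<open>(k, height (take k p))\<close>; the trivial path is \<open>[]\<close>.
\<close>

definition Motzkin :: "'x set \<Rightarrow> 'x path set" where
  "Motzkin X = {p. (\<forall>k\<le>length p. 0 \<le> height (take k p)) \<and> height p = 0
                  \<and> (\<forall>x. Level x \<in> set p \<longrightarrow> x \<in> X)}"

definition raising :: "'x path \<Rightarrow> 'x path" where
  "raising p = [Up] @ p @ [Down]"

definition peak_free :: "'x set \<Rightarrow> 'x path set" where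
  "peak_free X = {p \<in> Motzkin X. p \<noteq> [] \<and> \<not> (\<exists>u v. p = u @ [Up, Down] @ v)}"

definition valley_free :: "'x set \<Rightarrow> 'x path set" where
  "valley_free X = {p \<in> Motzkin X. \<not> (\<exists>u v. p = u @ [Down, Up] @ v)}"


section \<open>Leaf decorated forests\<close>

text \<open>
  \<open>Inner ts\<close> is a vertex with branches \<open>ts\<close>. It is only meant for non-empty \<open>ts\<close>, a childless
  vertex being a decorated \<open>Leaf\<close>; the set \<open>leaf_trees\<close> below enforces this.
\<close>

datatype 'x ltree = Leaf 'x | Inner "'x ltree list"

type_synonym 'x lforest = "'x ltree list"

inductive_set leaf_trees :: "'x set \<Rightarrow> 'x ltree set" for X where
  Leaf: "x \<in> X \<Longrightarrow> Leaf x \<in> leaf_trees X"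
| Inner: "ts \<noteq> [] \<Longrightarrow> \<forall>t\<in>set ts. t \<in> leaf_trees X \<Longrightarrow> Inner ts \<in> leaf_trees X"

definition leaf_forests :: "'x set \<Rightarrow> 'x lforest set" where
  "leaf_forests X = {ts. ts \<noteq> [] \<and> set ts \<subseteq> leaf_trees X}"

definition grafting :: "'x lforest \<Rightarrow> 'x lforest" where
  "grafting F = [Inner F]"

primrec lbranches :: "'x ltree \<Rightarrow> 'x ltree list" where
  "lbranches (Leaf x) = []"
| "lbranches (Inner ts) = ts"

text \<open>The subtrees rooted at the vertices of a tree, the root included.\<close>

primrec lsubtrees :: "'x ltree \<Rightarrow> 'x ltree set" where
  "lsubtrees (Leaf x) = {Leaf x}"
| "lsubtrees (Inner ts) = insert (Inner ts) (\<Union> (set (map lsubtrees ts)))"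

definition non_leaf :: "'x ltree \<Rightarrow> bool" where
  "non_leaf t \<longleftrightarrow> (\<nexists>x. t = Leaf x)"

definition adjacent_non_leaf_branches :: "'x ltree \<Rightarrow> bool" where
  "adjacent_non_leaf_branches r \<longleftrightarrow>
     (\<exists>us s t vs. lbranches r = us @ [s, t] @ vs \<and> non_leaf s \<and> non_leaf t)"

text \<open>
  The trees \<open>T\<^sub>1, \<dots>, T\<^sub>b\<close> of a forest count as the branches of a virtual root, so the
  condition is imposed on the vertices of the grafted tree \<open>Inner F\<close>. Without the virtual root,
  leaf-spaced forests would not be closed under grafting, and a forest of two adjacent
  non-leaf trees, whose path has a valley at height 0, would be leaf-spaced.
\<close>

definition leaf_spaced :: "'x set \<Rightarrow> 'x lforest set" where
  "leaf_spaced X =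
     {F \<in> leaf_forests X. \<not> (\<exists>r \<in> lsubtrees (Inner F). adjacent_non_leaf_branches r)}"


section \<open>Angularly decorated forests\<close>

text \<open>Undecorated planar rooted trees; \<open>Vertex []\<close> is the one-vertex tree.\<close>

datatype ptree = Vertex "ptree list"

type_synonym pforest = "ptree list"

definition planar_forests :: "pforest set" where
  "planar_forests = {F. F \<noteq> []}"

primrec tree_leaves :: "ptree \<Rightarrow> nat" where
  "tree_leaves (Vertex ts) = (if ts = [] then 1 else sum_list (map tree_leaves ts))"

definition leaves :: "pforest \<Rightarrow> nat" where
  "leaves F = sum_list (map tree_leaves F)"

definition angular_forests :: "'x set \<Rightarrow> (pforest \<times> 'x list) set" where
  "angular_forests X =
     {(F, xs). F \<in> planar_forests \<and> set xs \<subseteq> X \<and> length xs = leaves F - 1}"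

definition angular_grafting :: "pforest \<times> 'x list \<Rightarrow> pforest \<times> 'x list" where
  "angular_grafting = (\<lambda>(F, xs). ([Vertex F], xs))"

primrec psubtrees :: "ptree \<Rightarrow> ptree set" where
  "psubtrees (Vertex ts) = insert (Vertex ts) (\<Union> (set (map psubtrees ts)))"

definition ladder_free :: "'x set \<Rightarrow> (pforest \<times> 'x list) set" where
  "ladder_free X = {(F, xs) \<in> angular_forests X. F \<noteq> [Vertex []]
     \<and> \<not> (\<exists>t \<in> set F. \<exists>r \<in> psubtrees t. r = Vertex [Vertex []])}"


section \<open>Compatibility\<close>

text \<open>On \<open>A\<close> the product of \<open>a\<close> and \<open>b\<close> is defined only when it lies in \<open>A\<close>, and likewise on \<open>B\<close>.\<close>

definition product_compatible ::
  "'a set \<Rightarrow> ('a \<Rightarrow> 'a \<Rightarrow> 'a) \<Rightarrow> 'b set \<Rightarrow> ('b \<Rightarrow> 'b \<Rightarrow> 'b) \<Rightarrow> ('a \<Rightarrow> 'b) \<Rightarrow> bool" where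
  "product_compatible A mA B mB f \<longleftrightarrow>
     (\<forall>a\<in>A. \<forall>b\<in>A. mA a b \<in> A \<longrightarrow> mB (f a) (f b) \<in> B \<and> f (mA a b) = mB (f a) (f b))"

text \<open>The operators are total, so closure of \<open>A\<close> and \<open>B\<close> is part of compatibility.\<close>

definition operator_compatible ::
  "'a set \<Rightarrow> ('a \<Rightarrow> 'a) \<Rightarrow> 'b set \<Rightarrow> ('b \<Rightarrow> 'b) \<Rightarrow> ('a \<Rightarrow> 'b) \<Rightarrow> bool" where
  "operator_compatible A pA B pB f \<longleftrightarrow>
     (\<forall>a\<in>A. pA a \<in> A \<and> pB (f a) \<in> B \<and> f (pA a) = pB (f a))"

end

theory Submission
  imports Defs
begin

text \<open>
  All nine sets are read off from bracketed words. A word is turned into a path by writing a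
  level step for a variable and an up step and a down step for the two ends of a bracket. That
  this is a bijection onto the Motzkin paths is the usual matching of parentheses, carried out
  by a stack: reading a path from right to left, a down step opens a new word and an up step
  closes the topmost one into a bracket (lemmas \<open>path_word_word_path\<close> and
  \<open>word_path_path_word\<close>). A peak is then an empty bracket and a valley is a pair of adjacent
  brackets, which gives the restrictions to the semigroup words and to the Rota--Baxter words.

  A word is turned into a leaf decorated forest by letting variables be leaves and brackets be
  inner vertices. Inner vertices must have branches, so the words that occur are those without
  empty brackets; adjacent non-leaf branches are adjacent brackets.

  In a Rota--Baxter word the brackets at the top level are separated by variables. The \<open>k\<close>
  variables at the top level therefore leave \<open>k + 1\<close> gaps, each of which is empty or contains
  exactly one bracket. These gaps are the trees of the planar forest \<open>skeleton w\<close>, an empty gap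
  being the one-vertex tree, and the variables are the angles between the trees. Inductively the
  number of variables in the whole word is one less than the number of leaves. This
  correspondence is invertible (lemmas \<open>fill_angles_skeleton\<close> and \<open>skeleton_fill_angles\<close>),
  and an empty bracket becomes the two-vertex tree, which is why words without empty brackets
  correspond to ladder-free forests.

  Conditions on a word \<open>w\<close> are phrased as conditions on the letter \<open>Br w\<close>: the outer bracket
  plays the part of a virtual root, so that a single structural induction on letters treats the
  conditions at the top level and at all inner levels, and non-emptiness of a semigroup word is
  just the condition that the outer bracket is not empty.
\<close>

section \<open>Compatible bijections and their restrictions\<close>

lemma bij_betw_restrict:
  assumes "bij_betw f A B" "A' \<subseteq> A" "B' \<subseteq> B" "\<And>a. a \<in> A \<Longrightarrow> f a \<in> B' \<longleftrightarrow> a \<in> A'"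
  shows "bij_betw f A' B'"
proof (rule bij_betw_subset[OF assms(1,2)])
  have "f ` A = B" using assms(1) by (rule bij_betw_imp_surj_on)
  with assms(2-4) show "f ` A' = B'" by blast
qed

text \<open>The value \<open>pB (f a)\<close> lies in \<open>B\<close> because it is the image of \<open>pA a\<close>.\<close>

lemma operator_compatibleI:
  assumes "\<And>a. a \<in> A \<Longrightarrow> f a \<in> B" "\<And>a. a \<in> A \<Longrightarrow> pA a \<in> A"
    and "\<And>a. a \<in> A \<Longrightarrow> f (pA a) = pB (f a)"
  shows "operator_compatible A pA B pB f"
  using assms unfolding operator_compatible_def by metis

lemma successively_iff_factors:
  "successively P xs \<longleftrightarrow> (\<forall>us a b vs. xs = us @ [a, b] @ vs \<longrightarrow> P a b)"
proof
  assume "successively P xs"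
  then show "\<forall>us a b vs. xs = us @ [a, b] @ vs \<longrightarrow> P a b"
    by (auto simp: successively_append_iff)
next
  show "\<forall>us a b vs. xs = us @ [a, b] @ vs \<longrightarrow> P a b \<Longrightarrow> successively P xs"
  proof (induction xs)
    case (Cons a xs)
    have "successively P xs"
      using Cons.prems by (intro Cons.IH) (metis append_Cons)
    moreover have "P a b" if "xs = b # ys" for b ys
      using Cons.prems that by (metis append_Cons append_Nil)
    ultimately show ?case
      by (cases xs) auto
  qed simp
qed


section \<open>The three classes of bracketed words\<close>

text \<open>The levels are increasing, since the bracketing of a larger set is larger. So the finitely
  many letters of a word may be assigned to a common level, and the union of the levels solves
  the recursive equation that the levels approximate. Words excluded at every level, namely
  none or the empty one, are collected in \<open>N\<close>.\<close>

lemma union_of_levels: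
  fixes L :: "nat \<Rightarrow> 'x word set"
  assumes L0: "L 0 = lists (Var ` X) - N"
    and LS: "\<And>n. L (Suc n) = lists (Var ` X \<union> Br ` L n) - N"
  shows "(\<Union>n. L n) = lists (Var ` X \<union> Br ` (\<Union>n. L n)) - N"
proof -
  have lists_L: "lists (Var ` X \<union> Br ` A) \<subseteq> lists (Var ` X \<union> Br ` B)" if "A \<subseteq> B" for A B
    using that by (intro lists_mono Un_mono image_mono order_refl)
  have inc: "L n \<subseteq> L (Suc n)" for n
  proof (induction n)
    case 0
    show ?case unfolding L0 LS by (intro Diff_mono lists_mono Un_upper1 order_refl)
  next
    case (Suc n)
    from lists_L[OF this] show ?case by (subst (1 2) LS) (rule Diff_mono[OF _ order_refl])
  qed
  have mono: "L m \<subseteq> L n" if "m \<le> n" for m n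
    using inc that by (rule lift_Suc_mono_le)
  have "\<exists>n. w \<in> lists (Var ` X \<union> Br ` L n)" if "w \<in> lists (Var ` X \<union> Br ` (\<Union>n. L n))" for w
    using that
  proof (induction w)
    case (Cons a w)
    from Cons obtain m where m: "w \<in> lists (Var ` X \<union> Br ` L m)" by auto
    from Cons obtain k where k: "a \<in> Var ` X \<union> Br ` L k" by auto
    have "w \<in> lists (Var ` X \<union> Br ` L (max m k))"
      using m lists_L[OF mono[of m "max m k"]] by auto
    moreover have "a \<in> Var ` X \<union> Br ` L (max m k)"
      using k mono[of k "max m k"] by auto
    ultimately show ?case by (metis lists.Cons)
  qed simp
  then have "lists (Var ` X \<union> Br ` (\<Union>n. L n)) - N \<subseteq> (\<Union>n. L (Suc n))"
    unfolding LS by fast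
  moreover have "L n \<subseteq> lists (Var ` X \<union> Br ` (\<Union>n. L n)) - N" for n
  proof -
    have "L (Suc n) \<subseteq> lists (Var ` X \<union> Br ` (\<Union>n. L n)) - N"
      by (subst LS) (rule Diff_mono[OF lists_L order_refl], rule UN_upper[OF UNIV_I])
    with inc show ?thesis by (rule order_trans)
  qed
  moreover have "(\<Union>n. L (Suc n)) \<subseteq> (\<Union>n. L n)"
    by (intro UN_least UN_upper UNIV_I)
  ultimately show ?thesis
    by (intro subset_antisym UN_least) (auto intro: order_trans)
qed

lemma M_words_unfold: "M_words X = lists (Var ` X \<union> Br ` M_words X)"
  unfolding M_words_def
  using union_of_levels[of "M_level X" X "{}"] by (simp add: free_monoid_def)

lemma S_words_unfold: "S_words X = lists (Var ` X \<union> Br ` S_words X) - {[]}"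
  unfolding S_words_def
  using union_of_levels[of "S_level X" X "{[]}"] by (simp add: free_semigroup_def)

primrec filled :: "'x letter \<Rightarrow> bool" where
  "filled (Var x) = True"
| "filled (Br w) = (w \<noteq> [] \<and> (\<forall>b \<in> set (map filled w). b))"

definition is_bracket :: "'x letter \<Rightarrow> bool" where
  "is_bracket a \<longleftrightarrow> (\<exists>w. a = Br w)"

lemma is_bracket_simps [simp]: "is_bracket (Br w)" "\<not> is_bracket (Var x)"
  by (simp_all add: is_bracket_def)

primrec spaced :: "'x letter \<Rightarrow> bool" where
  "spaced (Var x) = True"
| "spaced (Br w) = (successively (\<lambda>a b. is_bracket a \<longrightarrow> \<not> is_bracket b) w
                      \<and> (\<forall>b \<in> set (map spaced w). b))"

lemma M_words_iff: "w \<in> M_words X \<longleftrightarrow> set_letter (Br w) \<subseteq> X"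
proof -
  have "a \<in> Var ` X \<union> Br ` M_words X \<longleftrightarrow> set_letter a \<subseteq> X" for a
  proof (induction a)
    case (Br w)
    have "w \<in> M_words X \<longleftrightarrow> (\<forall>a\<in>set w. a \<in> Var ` X \<union> Br ` M_words X)"
      by (subst (1) M_words_unfold) (simp only: in_lists_conv_set)
    with Br show ?case by (simp add: image_iff subset_iff) blast
  qed auto
  from this[of "Br w"] show ?thesis by auto
qed

lemma S_words_iff: "w \<in> S_words X \<longleftrightarrow> w \<in> M_words X \<and> filled (Br w)"
proof -
  have "a \<in> Var ` X \<union> Br ` S_words X \<longleftrightarrow> set_letter a \<subseteq> X \<and> filled a" for a
  proof (induction a)
    case (Br w)
    have "w \<in> S_words X
            \<longleftrightarrow> w \<noteq> [] \<and> (\<forall>a\<in>set w. a \<in> Var ` X \<union> Br ` S_words X)"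
      by (subst (1) S_words_unfold) (simp only: in_lists_conv_set Diff_iff singleton_iff conj_commute)
    with Br show ?case by (simp add: image_iff subset_iff) blast
  qed auto
  from this[of "Br w"] show ?thesis by (auto simp: M_words_iff)
qed

lemma has_adjacent_brackets_iff: "has_adjacent_brackets w \<longleftrightarrow> \<not> spaced (Br w)"
proof
  show "has_adjacent_brackets w \<Longrightarrow> \<not> spaced (Br w)"
    by (induction rule: has_adjacent_brackets.induct) (auto simp: successively_append_iff)
next
  have "\<not> spaced a \<Longrightarrow> \<exists>w. a = Br w \<and> has_adjacent_brackets w" for a :: "'a letter"
  proof (induction a)
    case (Br w)
    then consider "\<not> successively (\<lambda>a b. is_bracket a \<longrightarrow> \<not> is_bracket b) w"
      | a where "a \<in> set w" "\<not> spaced a" by auto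
    then show ?case
    proof cases
      case 1
      then obtain us a b vs where "w = us @ [a, b] @ vs" "is_bracket a" "is_bracket b"
        by (auto simp: successively_iff_factors)
      then show ?thesis
        by (metis has_adjacent_brackets.here is_bracket_def)
    next
      case 2
      with Br.IH obtain v where v: "a = Br v" "has_adjacent_brackets v" by blast
      from 2 obtain us vs where "w = us @ [a] @ vs" by (auto dest: split_list)
      with v show ?thesis by (blast intro: has_adjacent_brackets.inside)
    qed
  qed simp
  from this[of "Br w"] show "\<not> spaced (Br w) \<Longrightarrow> has_adjacent_brackets w" by auto
qed

lemma R_words_iff: "w \<in> R_words X \<longleftrightarrow> w \<in> M_words X \<and> spaced (Br w)"
  by (simp add: R_words_def has_adjacent_brackets_iff)

lemma bracket_closed:
  "w \<in> M_words X \<Longrightarrow> bracket w \<in> M_words X"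
  "w \<in> S_words X \<Longrightarrow> bracket w \<in> S_words X"
  "w \<in> R_words X \<Longrightarrow> bracket w \<in> R_words X"
  by (auto simp: S_words_iff R_words_iff M_words_iff bracket_def)


section \<open>Words as Motzkin paths\<close>

primrec letter_path :: "'x letter \<Rightarrow> 'x path" where
  "letter_path (Var x) = [Level x]"
| "letter_path (Br w) = Up # concat (map letter_path w) @ [Down]"

definition word_path :: "'x word \<Rightarrow> 'x path" where
  "word_path w = concat (map letter_path w)"

lemma word_path_simps [simp]:
  "word_path [] = []"
  "word_path (a # w) = letter_path a @ word_path w"
  "word_path (v @ w) = word_path v @ word_path w"
  "letter_path (Br w) = Up # word_path w @ [Down]"
  by (simp_all add: word_path_def)

declare letter_path.simps(2) [simp del]

lemma word_path_bracket: "word_path (bracket w) = raising (word_path w)"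
  by (simp add: bracket_def raising_def)

lemma letter_path_not_Nil [simp]: "letter_path a \<noteq> []"
  by (cases a) auto

lemma word_path_eq_Nil [simp]: "word_path w = [] \<longleftrightarrow> w = []"
  by (cases w) auto

text \<open>A stack of words \<open>w\<^sub>0, w\<^sub>1, \<dots>, w\<^sub>h\<close> describes a path that descends by \<open>h\<close>: between
  consecutive words stands a down step whose matching up step lies further to the left. Reading
  one more step at the left end either extends the topmost word, or opens a new one, or
  matches the topmost open down step. An up step without a partner, which a Motzkin path does
  not have, is skipped.\<close>

fun read_step :: "'x step \<Rightarrow> 'x word list \<Rightarrow> 'x word list" where
  "read_step (Level x) (w # ws) = (Var x # w) # ws"
| "read_step Down ws = [] # ws"
| "read_step Up (v # w # ws) = (Br v # w) # ws"
| "read_step s ws = ws"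

definition path_word :: "'x path \<Rightarrow> 'x word" where
  "path_word p = hd (foldr read_step p [[]])"

definition stack_path :: "'x word list \<Rightarrow> 'x path" where
  "stack_path ws = word_path (hd ws) @ concat (map (\<lambda>w. Down # word_path w) (tl ws))"

lemma read_letter_path:
  "foldr read_step (letter_path a) (w # ws) = (a # w) # ws"
proof (induction a arbitrary: w ws)
  case (Br u)
  have "foldr read_step (word_path v) (w # ws) = (v @ w) # ws" if "set v \<subseteq> set u" for v w ws
    using that by (induction v) (auto simp: Br)
  then show ?case by simp
qed simp

lemma path_word_word_path [simp]: "path_word (word_path w) = w"
proof -
  have "foldr read_step (word_path w) [[]] = [w]"
    by (induction w) (auto simp: read_letter_path)
  then show ?thesis by (simp add: path_word_def)
qed

lemma height_simps [simp]:
  "height [] = 0" "height (s # p) = rise s + height p" "height (p @ q) = height p + height q"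
  by (simp_all add: height_def)

text \<open>The length of the stack is one more than the descent. The hypothesis on final segments
  guarantees that an up step always finds an open down step.\<close>

lemma stack_path_read:
  assumes "\<And>k. height (drop k p) \<le> 0"
  shows "int (length (foldr read_step p [[]])) = 1 - height p
           \<and> stack_path (foldr read_step p [[]]) = p"
  using assms
proof (induction p)
  case Nil
  then show ?case by (simp add: stack_path_def)
next
  case (Cons s p)
  let ?ws = "foldr read_step p [[]]"
  have "height (drop k p) \<le> 0" for k using Cons.prems[of "Suc k"] by simp
  with Cons.IH have len: "int (length ?ws) = 1 - height p" and path: "stack_path ?ws = p"
    by simp_all
  have le: "rise s + height p \<le> 0" using Cons.prems[of 0] by simp
  from \<open>\<And>k. height (drop k p) \<le> 0\<close>[of 0] have "height p \<le> 0" by simp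
  with len obtain w ws where ws: "?ws = w # ws" by (cases ?ws) auto
  show ?case
  proof (cases s)
    case Up
    with len le ws obtain v us where "ws = v # us" by (cases ws) auto
    with Up len path ws show ?thesis by (auto simp: stack_path_def)
  qed (use len path ws in \<open>auto simp: stack_path_def\<close>)
qed

lemma word_path_path_word:
  assumes "p \<in> Motzkin X"
  shows "word_path (path_word p) = p"
proof -
  have 0: "height p = 0" and pre: "\<And>k. k \<le> length p \<Longrightarrow> 0 \<le> height (take k p)"
    using assms by (auto simp: Motzkin_def)
  have "height (drop k p) \<le> 0" for k
  proof (cases "k \<le> length p")
    case True
    have "height (take k p) + height (drop k p) = height p"
      by (metis append_take_drop_id height_simps(3))
    with 0 pre[OF True] show ?thesis by simp
  qed simp
  from stack_path_read[OF this] 0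
  have "length (foldr read_step p [[]]) = 1" "stack_path (foldr read_step p [[]]) = p" by auto
  then show ?thesis
    by (cases "foldr read_step p [[]]") (auto simp: stack_path_def path_word_def)
qed

lemma height_letter_path [simp]: "height (letter_path a) = 0"
proof (induction a)
  case (Br w)
  then have "height (word_path w) = 0" by (induction w) auto
  then show ?case by simp
qed simp

lemma height_word_path [simp]: "height (word_path w) = 0"
  by (induction w) auto

lemma height_take_letter_path: "0 \<le> height (take k (letter_path a))"
proof (induction a arbitrary: k)
  case (Br w)
  have "0 \<le> height (take k (word_path v))" if "set v \<subseteq> set w" for v k
    using that
  proof (induction v arbitrary: k)
    case (Cons a v)
    then show ?case using Br[of a k] by auto
  qed simp
  from this[of w] show ?case
    by (cases k) (auto simp: take_Cons' add_increasing2)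
qed (simp add: take_Cons')

lemma height_take_word_path: "0 \<le> height (take k (word_path w))"
  by (induction w arbitrary: k) (auto simp: height_take_letter_path)

lemma Level_in_letter_path: "Level x \<in> set (letter_path a) \<longleftrightarrow> x \<in> set_letter a"
proof (induction a)
  case (Br w)
  then show ?case by (auto simp: word_path_def)
qed auto

lemma word_path_in_Motzkin: "word_path w \<in> Motzkin X \<longleftrightarrow> w \<in> M_words X"
proof -
  have "Level x \<in> set (word_path w) \<longleftrightarrow> x \<in> set_letter (Br w)" for x
    using Level_in_letter_path[of x "Br w"] by simp
  then show ?thesis
    by (auto simp: Motzkin_def M_words_iff height_take_word_path)
qed

lemma bij_word_path: "bij_betw word_path (M_words X) (Motzkin X)"
proof (rule bij_betw_byWitness[where f' = path_word])
  show "path_word ` Motzkin X \<subseteq> M_words X"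
    by (auto simp: word_path_path_word simp flip: word_path_in_Motzkin)
qed (auto simp: word_path_path_word word_path_in_Motzkin)

lemma hd_last_letter_path:
  "hd (letter_path a) \<noteq> Down" "last (letter_path a) \<noteq> Up"
  "hd (letter_path a) = Up \<longleftrightarrow> is_bracket a" "last (letter_path a) = Down \<longleftrightarrow> is_bracket a"
  by (cases a; simp)+

lemma hd_word_path: "w \<noteq> [] \<Longrightarrow> hd (word_path w) = hd (letter_path (hd w))"
  by (cases w) auto

lemma last_word_path: "w \<noteq> [] \<Longrightarrow> last (word_path w) = last (letter_path (last w))"
  by (cases w rule: rev_cases) auto

abbreviation no_peak :: "'x path \<Rightarrow> bool" where
  "no_peak \<equiv> successively (\<lambda>s t. s = Up \<longrightarrow> t \<noteq> Down)"

abbreviation no_valley :: "'x path \<Rightarrow> bool" where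
  "no_valley \<equiv> successively (\<lambda>s t. s = Down \<longrightarrow> t \<noteq> Up)"

text \<open>The paths of letters do not begin with a down step or end with an up step, so joining
  them creates no peak; only a bracket with nothing inside does.\<close>

lemma no_peak_letter_path: "no_peak (letter_path a) \<longleftrightarrow> filled a"
proof (induction a)
  case (Br w)
  have "no_peak (word_path v) \<longleftrightarrow> (\<forall>a\<in>set v. filled a)" if "set v \<subseteq> set w" for v
    using that
    by (induction v) (auto simp: Br successively_append_iff hd_last_letter_path)
  from this[of w] show ?case
    by (cases "w = []")
      (auto simp: successively_Cons successively_append_iff hd_word_path last_word_path
        hd_last_letter_path)
qed simp

text \<open>Dually, a bracket begins with an up step and ends with a down step, so valleys arise only
  where two brackets meet; the outer steps of a bracket create none.\<close>

lemma no_valley_letter_path: "no_valley (letter_path a) \<longleftrightarrow> spaced a"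
proof (induction a)
  case (Br w)
  have "no_valley (word_path v) \<longleftrightarrow>
      successively (\<lambda>a b. is_bracket a \<longrightarrow> \<not> is_bracket b) v \<and> (\<forall>a\<in>set v. spaced a)"
    if "set v \<subseteq> set w" for v
    using that
    by (induction v)
      (auto simp: Br successively_append_iff successively_Cons hd_last_letter_path hd_word_path)
  from this[of w] show ?case
    by (cases "w = []")
      (auto simp: successively_Cons successively_append_iff)
qed simp

lemma word_path_in_peak_free: "word_path w \<in> peak_free X \<longleftrightarrow> w \<in> S_words X"
proof -
  have "filled (Br w) \<longleftrightarrow> w \<noteq> [] \<and> no_peak (word_path w)"
    using no_peak_letter_path[of "Br w"]
    by (auto simp: successively_Cons successively_append_iff hd_word_path last_word_path
        hd_last_letter_path split: if_splits)
  then show ?thesis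
    by (auto simp: peak_free_def S_words_iff word_path_in_Motzkin successively_iff_factors)
qed

lemma word_path_in_valley_free: "word_path w \<in> valley_free X \<longleftrightarrow> w \<in> R_words X"
proof -
  have "spaced (Br w) \<longleftrightarrow> no_valley (word_path w)"
    using no_valley_letter_path[of "Br w"]
    by (auto simp: successively_Cons successively_append_iff)
  then show ?thesis
    by (auto simp: valley_free_def R_words_iff word_path_in_Motzkin successively_iff_factors)
qed

lemma path_word_append:
  assumes "p \<in> Motzkin X" "q \<in> Motzkin X"
  shows "path_word (p @ q) = path_word p @ path_word q"
  using assms by (metis path_word_word_path word_path_path_word word_path_simps(3))

lemma path_word_raising:
  assumes "p \<in> Motzkin X"
  shows "path_word (raising p) = bracket (path_word p)"
  using assms by (metis path_word_word_path word_path_path_word word_path_bracket)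

lemma raising_closed:
  "p \<in> peak_free X \<Longrightarrow> raising p \<in> peak_free X"
  "p \<in> valley_free X \<Longrightarrow> raising p \<in> valley_free X"
proof -
  have eq: "p = word_path (path_word p)" "raising p = word_path (bracket (path_word p))"
    if "p \<in> Motzkin X"
    using word_path_path_word[OF that] by (simp_all add: word_path_bracket)
  show "raising p \<in> peak_free X" if "p \<in> peak_free X"
  proof -
    have M: "p \<in> Motzkin X" using that by (simp add: peak_free_def)
    have "path_word p \<in> S_words X"
      using that by (subst (asm) eq(1)[OF M]) (simp only: word_path_in_peak_free)
    then show ?thesis
      by (subst eq(2)[OF M]) (simp add: word_path_in_peak_free bracket_closed)
  qed
  show "raising p \<in> valley_free X" if "p \<in> valley_free X"
  proof -
    have M: "p \<in> Motzkin X" using that by (simp add: valley_free_def)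
    have "path_word p \<in> R_words X"
      using that by (subst (asm) eq(1)[OF M]) (simp only: word_path_in_valley_free)
    then show ?thesis
      by (subst eq(2)[OF M]) (simp add: word_path_in_valley_free bracket_closed)
  qed
qed


section \<open>Words as leaf decorated forests\<close>

primrec letter_tree :: "'x letter \<Rightarrow> 'x ltree" where
  "letter_tree (Var x) = Leaf x"
| "letter_tree (Br w) = Inner (map letter_tree w)"

primrec tree_letter :: "'x ltree \<Rightarrow> 'x letter" where
  "tree_letter (Leaf x) = Var x"
| "tree_letter (Inner ts) = Br (map tree_letter ts)"

lemma tree_letter_letter_tree [simp]: "tree_letter (letter_tree a) = a"
  by (induction a) (auto intro: map_idI)

lemma letter_tree_tree_letter [simp]: "letter_tree (tree_letter t) = t"
  by (induction t) (auto intro: map_idI)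

text \<open>Inner vertices need a branch, and so only filled letters become decorated trees.\<close>

lemma letter_tree_in_leaf_trees:
  "letter_tree a \<in> leaf_trees X \<longleftrightarrow> set_letter a \<subseteq> X \<and> filled a"
proof (induction a)
  case (Br w)
  then show ?case
    by (subst leaf_trees.simps) (simp add: UN_subset_iff ball_conj_distrib, blast)
qed (subst leaf_trees.simps, auto)

lemma map_letter_tree_in_leaf_forests:
  "map letter_tree w \<in> leaf_forests X \<longleftrightarrow> w \<in> S_words X"
proof -
  have "map letter_tree w \<in> leaf_forests X \<longleftrightarrow> letter_tree (Br w) \<in> leaf_trees X"
    by (subst leaf_trees.simps) (auto simp: leaf_forests_def)
  then show ?thesis
    unfolding letter_tree_in_leaf_trees by (simp only: S_words_iff M_words_iff)
qed

lemma non_leaf_letter_tree [simp]: "non_leaf (letter_tree a) \<longleftrightarrow> is_bracket a"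
  by (cases a) (auto simp: non_leaf_def)

lemma adjacent_non_leaf_branches_iff:
  "adjacent_non_leaf_branches r
     \<longleftrightarrow> \<not> successively (\<lambda>s t. non_leaf s \<longrightarrow> \<not> non_leaf t) (lbranches r)"
  by (auto simp: adjacent_non_leaf_branches_def successively_iff_factors)

lemma adjacent_non_leaf_branches_letter_tree:
  "(\<exists>r\<in>lsubtrees (letter_tree a). adjacent_non_leaf_branches r) \<longleftrightarrow> \<not> spaced a"
proof (induction a)
  case (Br w)
  then show ?case
    by (auto simp: adjacent_non_leaf_branches_iff successively_map)
qed (simp add: adjacent_non_leaf_branches_iff)

lemma map_letter_tree_in_leaf_spaced:
  "map letter_tree w \<in> leaf_spaced X \<longleftrightarrow> w \<in> S_words X \<inter> R_words X"
  using adjacent_non_leaf_branches_letter_tree[of "Br w"]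
  by (auto simp: leaf_spaced_def map_letter_tree_in_leaf_forests S_words_iff R_words_iff)

lemma map_letter_tree_bracket: "map letter_tree (bracket w) = grafting (map letter_tree w)"
  by (simp add: bracket_def grafting_def)

lemma bij_map_letter_tree:
  assumes "\<And>w. map letter_tree w \<in> B \<longleftrightarrow> w \<in> A"
  shows "bij_betw (map letter_tree) A B" "bij_betw (map tree_letter) B A"
proof -
  have inv: "map letter_tree (map tree_letter F) = F" "map tree_letter (map letter_tree w) = w"
    for F :: "'a lforest" and w :: "'a word"
    by (auto intro: map_idI)
  have "map tree_letter F \<in> A" if "F \<in> B" for F
    using that assms inv(1) by metis
  with assms inv show "bij_betw (map letter_tree) A B" "bij_betw (map tree_letter) B A"
    by (auto intro!: bij_betw_byWitness[where f' = "map tree_letter"]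
        bij_betw_byWitness[where f' = "map letter_tree"] simp del: map_map)
qed


section \<open>Rota--Baxter words as angularly decorated forests\<close>

text \<open>Each tree of the skeleton is a gap between variables at the top level. A bracket
  followed by a variable fills the gap before that variable, so both are consumed together.
  Adjacent brackets share a gap, which is excluded in Rota--Baxter words; their value is chosen
  such that every skeleton is non-empty.\<close>

fun skeleton :: "'x word \<Rightarrow> pforest" where
  "skeleton [] = [Vertex []]"
| "skeleton (Var x # w) = Vertex [] # skeleton w"
| "skeleton [Br u] = [Vertex (skeleton u)]"
| "skeleton (Br u # Var x # w) = Vertex (skeleton u) # skeleton w"
| "skeleton (Br u # Br v # w) = Vertex (skeleton u) # skeleton (Br v # w)"

primrec letter_vars :: "'x letter \<Rightarrow> 'x list" where
  "letter_vars (Var x) = [x]"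
| "letter_vars (Br w) = concat (map letter_vars w)"

definition angular :: "'x word \<Rightarrow> pforest \<times> 'x list" where
  "angular w = (skeleton w, letter_vars (Br w))"

text \<open>The first tree \<open>Vertex G\<close> of a forest uses one decoration less than it has leaves, and
  the next decoration sits between this tree and the following one. For the one-vertex tree,
  with \<open>G\<close> empty, the truncated difference is 0 as required.\<close>

fun fill_angles :: "pforest \<Rightarrow> 'x list \<Rightarrow> 'x word" where
  "fill_angles [] xs = []"
| "fill_angles (Vertex G # F) xs =
     (let n = leaves G - 1 in
       (if G = [] then [] else [Br (fill_angles G (take n xs))]) @
       (if F = [] then [] else Var (xs ! n) # fill_angles F (drop (Suc n) xs)))"

lemma skeleton_not_Nil [simp]: "skeleton w \<noteq> []"
  by (cases w rule: skeleton.cases) auto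

lemma leaves_simps [simp]:
  "leaves [] = 0"
  "leaves (Vertex G # F) = (if G = [] then 1 else leaves G) + leaves F"
  by (simp_all add: leaves_def)

lemma leaves_pos: "F \<noteq> [] \<Longrightarrow> 0 < leaves F"
proof -
  have "0 < tree_leaves t" for t
  proof (induction t)
    case (Vertex ts)
    then show ?case by (cases ts) auto
  qed
  then show "F \<noteq> [] \<Longrightarrow> 0 < leaves F" by (cases F) (auto simp: leaves_def)
qed

lemma successively_Var [simp]:
  "successively (\<lambda>a b. is_bracket a \<longrightarrow> \<not> is_bracket b) (Var x # w)
     \<longleftrightarrow> successively (\<lambda>a b. is_bracket a \<longrightarrow> \<not> is_bracket b) w"
  by (cases w) auto

lemma leaves_skeleton:
  "spaced (Br w) \<Longrightarrow> leaves (skeleton w) = Suc (length (letter_vars (Br w)))"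
  by (induction w rule: skeleton.induct) auto

text \<open>The count of leaves makes the first tree take exactly the variables of the first bracket
  from the decoration, so that each bracket is rebuilt from its own variables.\<close>

lemma fill_angles_skeleton:
  "spaced (Br w) \<Longrightarrow> fill_angles (skeleton w) (letter_vars (Br w)) = w"
proof (induction w rule: skeleton.induct)
  case (3 u)
  then show ?case using leaves_skeleton[of u] by simp
next
  case (4 u x w)
  then show ?case using leaves_skeleton[of u] by simp
qed auto

text \<open>A forest of \<open>b\<close> trees with \<open>n\<^sub>1, \<dots>, n\<^sub>b\<close> leaves has
  \<open>n\<^sub>1 + \<dots> + n\<^sub>b - 1 = (n\<^sub>1 - 1) + \<dots> + (n\<^sub>b - 1) + (b - 1)\<close> decorations, which are just
  enough for the angles inside the trees and between them. Consecutive brackets are separated by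
  the variable of the angle between their trees, whence the result is spaced.\<close>

lemma skeleton_fill_angles:
  assumes "F \<noteq> []" "length xs = leaves F - 1"
  shows "skeleton (fill_angles F xs) = F \<and> letter_vars (Br (fill_angles F xs)) = xs
           \<and> spaced (Br (fill_angles F xs))"
  using assms
proof (induction F xs rule: fill_angles.induct)
  case (2 G F xs)
  define n where "n = leaves G - 1"
  have F: "skeleton (fill_angles F (drop (Suc n) xs)) = F
      \<and> letter_vars (Br (fill_angles F (drop (Suc n) xs))) = drop (Suc n) xs
      \<and> spaced (Br (fill_angles F (drop (Suc n) xs)))" and n: "n < length xs" if "F \<noteq> []"
    using 2 that leaves_pos[of F] leaves_pos[of G]
    by (auto simp: n_def split: if_splits)
  have G: "skeleton (fill_angles G (take n xs)) = G
      \<and> letter_vars (Br (fill_angles G (take n xs))) = take n xs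
      \<and> spaced (Br (fill_angles G (take n xs)))" if "G \<noteq> []"
    using 2 that leaves_pos[of G] by (auto simp: n_def)
  show ?case
  proof (cases "F = []")
    case True
    then show ?thesis using G 2(4) by (auto simp: n_def Let_def)
  next
    case False
    have "take n xs @ xs ! n # drop (Suc n) xs = xs"
      using n[OF False] by (rule id_take_nth_drop[symmetric])
    then show ?thesis
      using F[OF False] G False
      by (cases "G = []") (auto simp: Let_def n_def)
  qed
qed simp

lemma set_letter_vars: "set (letter_vars a) = set_letter a"
  by (induction a) auto

lemma bij_angular: "bij_betw angular (R_words X) (angular_forests X)"
proof (rule bij_betw_byWitness[where f' = "\<lambda>(F, xs). fill_angles F xs"])
  show "\<forall>w\<in>R_words X. (\<lambda>(F, xs). fill_angles F xs) (angular w) = w"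
    by (simp add: angular_def R_words_iff fill_angles_skeleton
        del: spaced.simps letter_vars.simps)
  show "\<forall>a\<in>angular_forests X. angular ((\<lambda>(F, xs). fill_angles F xs) a) = a"
    by (auto simp: angular_def angular_forests_def planar_forests_def skeleton_fill_angles
        simp del: spaced.simps letter_vars.simps)
  show "angular ` R_words X \<subseteq> angular_forests X"
    by (auto simp: R_words_iff M_words_iff angular_def angular_forests_def planar_forests_def
        leaves_skeleton set_letter_vars simp del: spaced.simps letter_vars.simps letter.set)
  show "(\<lambda>(F, xs). fill_angles F xs) ` angular_forests X \<subseteq> R_words X"
  proof clarify
    fix F and xs :: "'a list"
    assume "(F, xs) \<in> angular_forests X"
    then have "F \<noteq> []" "length xs = leaves F - 1" "set xs \<subseteq> X"
      by (auto simp: angular_forests_def planar_forests_def)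
    then show "fill_angles F xs \<in> R_words X"
      using skeleton_fill_angles[of F xs] set_letter_vars[of "Br (fill_angles F xs)"]
      by (metis M_words_iff R_words_iff)
  qed
qed

lemma skeleton_eq_vertex_iff: "skeleton w = [Vertex []] \<longleftrightarrow> w = []"
  by (cases w rule: skeleton.cases) auto

definition no_ladder :: "ptree \<Rightarrow> bool" where
  "no_ladder t \<longleftrightarrow> Vertex [Vertex []] \<notin> psubtrees t"

lemma no_ladder_Vertex [simp]:
  "no_ladder (Vertex F) \<longleftrightarrow> F \<noteq> [Vertex []] \<and> (\<forall>t\<in>set F. no_ladder t)"
  by (auto simp: no_ladder_def)

text \<open>Only the empty word has the one-vertex tree as its skeleton, so a ladder comes exactly from
  an empty bracket.\<close>

lemma no_ladder_skeleton:
  "spaced (Br w) \<Longrightarrow> (\<forall>t\<in>set (skeleton w). no_ladder t) \<longleftrightarrow> (\<forall>a\<in>set w. filled a)"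
  by (induction w rule: skeleton.induct) (simp_all add: skeleton_eq_vertex_iff)

lemma angular_in_ladder_free:
  assumes "w \<in> R_words X"
  shows "angular w \<in> ladder_free X \<longleftrightarrow> w \<in> S_words X \<inter> R_words X"
proof -
  have "angular w \<in> angular_forests X"
    using bij_betwE[OF bij_angular] assms by blast
  then have "angular w \<in> ladder_free X
      \<longleftrightarrow> skeleton w \<noteq> [Vertex []] \<and> (\<forall>t\<in>set (skeleton w). no_ladder t)"
    by (auto simp: ladder_free_def angular_def no_ladder_def)
  also have "\<dots> \<longleftrightarrow> filled (Br w)"
    using no_ladder_skeleton[of w] assms by (simp add: skeleton_eq_vertex_iff R_words_iff)
  finally show ?thesis
    using assms by (simp add: R_words_iff S_words_iff)
qed

lemma angular_bracket: "angular (bracket w) = angular_grafting (angular w)"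
  by (simp add: angular_def bracket_def angular_grafting_def)


section \<open>The commutative diagram\<close>

theorem theorem5p1:
  fixes X :: "'x set"
  assumes "X \<noteq> {}"
  shows "\<exists>(\<phi>MP :: 'x word \<Rightarrow> 'x path)
       (\<phi>SL :: 'x word \<Rightarrow> 'x path)
       (\<phi>RV :: 'x word \<Rightarrow> 'x path)
       (\<phi>LF :: 'x path \<Rightarrow> 'x lforest)
       (\<phi>VA :: 'x path \<Rightarrow> pforest \<times> 'x list)
       (\<phi>SRLV :: 'x word \<Rightarrow> 'x path)
       (\<phi>LVFl :: 'x path \<Rightarrow> 'x lforest)
       (\<phi>LVA0 :: 'x path \<Rightarrow> pforest \<times> 'x list)
       (\<phi>FlA0 :: 'x lforest \<Rightarrow> pforest \<times> 'x list).
      bij_betw \<phi>MP (M_words X) (Motzkin X)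
    \<and> bij_betw \<phi>SL (S_words X) (peak_free X)
    \<and> bij_betw \<phi>RV (R_words X) (valley_free X)
    \<and> bij_betw \<phi>LF (peak_free X) (leaf_forests X)
    \<and> bij_betw \<phi>VA (valley_free X) (angular_forests X)
    \<and> bij_betw \<phi>SRLV (S_words X \<inter> R_words X) (peak_free X \<inter> valley_free X)
    \<and> bij_betw \<phi>LVFl (peak_free X \<inter> valley_free X) (leaf_spaced X)
    \<and> bij_betw \<phi>LVA0 (peak_free X \<inter> valley_free X) (ladder_free X)
    \<and> bij_betw \<phi>FlA0 (leaf_spaced X) (ladder_free X)
    \<and> S_words X \<subseteq> M_words X
    \<and> R_words X \<subseteq> M_words X
    \<and> peak_free X \<subseteq> Motzkin X
    \<and> valley_free X \<subseteq> Motzkin X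
    \<and> S_words X \<inter> R_words X \<subseteq> S_words X
    \<and> S_words X \<inter> R_words X \<subseteq> R_words X
    \<and> peak_free X \<inter> valley_free X \<subseteq> peak_free X
    \<and> peak_free X \<inter> valley_free X \<subseteq> valley_free X
    \<and> leaf_spaced X \<subseteq> leaf_forests X
    \<and> ladder_free X \<subseteq> angular_forests X
    \<and> (\<forall>w\<in>S_words X. \<phi>SL w = \<phi>MP w)
    \<and> (\<forall>w\<in>R_words X. \<phi>RV w = \<phi>MP w)
    \<and> (\<forall>w\<in>S_words X \<inter> R_words X. \<phi>SRLV w = \<phi>SL w \<and> \<phi>SRLV w = \<phi>RV w)
    \<and> (\<forall>p\<in>peak_free X \<inter> valley_free X. \<phi>LVFl p = \<phi>LF p)
    \<and> (\<forall>p\<in>peak_free X \<inter> valley_free X. \<phi>LVA0 p = \<phi>VA p)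
    \<and> (\<forall>p\<in>peak_free X \<inter> valley_free X. (\<phi>FlA0 \<circ> \<phi>LVFl) p = \<phi>LVA0 p)
    \<and> product_compatible (M_words X) (@) (Motzkin X) (@) \<phi>MP
    \<and> product_compatible (S_words X) (@) (peak_free X) (@) \<phi>SL
    \<and> product_compatible (R_words X) (@) (valley_free X) (@) \<phi>RV
    \<and> product_compatible (peak_free X) (@) (leaf_forests X) (@) \<phi>LF
    \<and> product_compatible (S_words X \<inter> R_words X) (@) (peak_free X \<inter> valley_free X) (@) \<phi>SRLV
    \<and> product_compatible (peak_free X \<inter> valley_free X) (@) (leaf_spaced X) (@) \<phi>LVFl
    \<and> product_compatible (S_words X) (@) (M_words X) (@) id
    \<and> product_compatible (R_words X) (@) (M_words X) (@) id
    \<and> product_compatible (peak_free X) (@) (Motzkin X) (@) id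
    \<and> product_compatible (valley_free X) (@) (Motzkin X) (@) id
    \<and> product_compatible (S_words X \<inter> R_words X) (@) (S_words X) (@) id
    \<and> product_compatible (S_words X \<inter> R_words X) (@) (R_words X) (@) id
    \<and> product_compatible (peak_free X \<inter> valley_free X) (@) (peak_free X) (@) id
    \<and> product_compatible (peak_free X \<inter> valley_free X) (@) (valley_free X) (@) id
    \<and> product_compatible (leaf_spaced X) (@) (leaf_forests X) (@) id
    \<and> operator_compatible (M_words X) bracket (Motzkin X) raising \<phi>MP
    \<and> operator_compatible (S_words X) bracket (peak_free X) raising \<phi>SL
    \<and> operator_compatible (R_words X) bracket (valley_free X) raising \<phi>RV
    \<and> operator_compatible (peak_free X) raising (leaf_forests X) grafting \<phi>LF
    \<and> operator_compatible (valley_free X) raising (angular_forests X) angular_grafting \<phi>VA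
    \<and> operator_compatible (S_words X \<inter> R_words X) bracket (peak_free X \<inter> valley_free X) raising \<phi>SRLV
    \<and> operator_compatible (peak_free X \<inter> valley_free X) raising (leaf_spaced X) grafting \<phi>LVFl
    \<and> operator_compatible (peak_free X \<inter> valley_free X) raising (ladder_free X) angular_grafting \<phi>LVA0
    \<and> operator_compatible (leaf_spaced X) grafting (ladder_free X) angular_grafting \<phi>FlA0
    \<and> operator_compatible (S_words X) bracket (M_words X) bracket id
    \<and> operator_compatible (R_words X) bracket (M_words X) bracket id
    \<and> operator_compatible (peak_free X) raising (Motzkin X) raising id
    \<and> operator_compatible (valley_free X) raising (Motzkin X) raising id
    \<and> operator_compatible (S_words X \<inter> R_words X) bracket (S_words X) bracket id
    \<and> operator_compatible (S_words X \<inter> R_words X) bracket (R_words X) bracket id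
    \<and> operator_compatible (peak_free X \<inter> valley_free X) raising (peak_free X) raising id
    \<and> operator_compatible (peak_free X \<inter> valley_free X) raising (valley_free X) raising id
    \<and> operator_compatible (leaf_spaced X) grafting (leaf_forests X) grafting id
    \<and> operator_compatible (ladder_free X) angular_grafting (angular_forests X) angular_grafting id"
proof -
  let ?LF = "map letter_tree \<circ> path_word"
  let ?VA = "angular \<circ> path_word"
  let ?FA = "angular \<circ> map tree_letter"
  have sub: "S_words X \<subseteq> M_words X" "R_words X \<subseteq> M_words X"
    "peak_free X \<subseteq> Motzkin X" "valley_free X \<subseteq> Motzkin X"
    "leaf_spaced X \<subseteq> leaf_forests X" "ladder_free X \<subseteq> angular_forests X"
    by (auto simp: S_words_iff R_words_iff peak_free_def valley_free_def leaf_spaced_def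
        ladder_free_def)

  have W: "bij_betw word_path (S_words X) (peak_free X)"
    "bij_betw word_path (R_words X) (valley_free X)"
    "bij_betw word_path (S_words X \<inter> R_words X) (peak_free X \<inter> valley_free X)"
    using sub
    by (auto intro!: bij_betw_restrict[OF bij_word_path]
        simp: word_path_in_peak_free word_path_in_valley_free)
  have P: "bij_betw path_word B A" if "bij_betw word_path A B" for A :: "'x word set" and B
  proof (rule bij_betw_byWitness[where f' = word_path])
    have "B = word_path ` A" using that by (simp add: bij_betw_def)
    then show "\<forall>p\<in>B. word_path (path_word p) = p" "\<forall>w\<in>A. path_word (word_path w) = w"
      "path_word ` B \<subseteq> A" "word_path ` A \<subseteq> B"
      by auto
  qed
  note PW = W[THEN P]

  have LF: "bij_betw ?LF (peak_free X) (leaf_forests X)"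
    "bij_betw ?LF (peak_free X \<inter> valley_free X) (leaf_spaced X)"
    by (rule bij_betw_trans[OF PW(1) bij_map_letter_tree(1)[OF map_letter_tree_in_leaf_forests]],
        rule bij_betw_trans[OF PW(3) bij_map_letter_tree(1)[OF map_letter_tree_in_leaf_spaced]])
  have A0: "bij_betw angular (S_words X \<inter> R_words X) (ladder_free X)"
    using sub by (intro bij_betw_restrict[OF bij_angular]) (auto simp: angular_in_ladder_free)
  have VA: "bij_betw ?VA (valley_free X) (angular_forests X)"
    "bij_betw ?VA (peak_free X \<inter> valley_free X) (ladder_free X)"
    by (rule bij_betw_trans[OF PW(2) bij_angular], rule bij_betw_trans[OF PW(3) A0])
  have FA: "bij_betw ?FA (leaf_spaced X) (ladder_free X)"
    using bij_map_letter_tree(2)[OF map_letter_tree_in_leaf_spaced] A0 by (rule bij_betw_trans)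

  have LF_append: "?LF (p @ q) = ?LF p @ ?LF q" if "p \<in> peak_free X" "q \<in> peak_free X" for p q
    using path_word_append[of p X q] subsetD[OF sub(3)] that by simp
  have LF_raising: "?LF (raising p) = grafting (?LF p)"
    and VA_raising: "?VA (raising p) = angular_grafting (?VA p)" if "p \<in> Motzkin X" for p
    using that by (simp_all add: path_word_raising[of p X] map_letter_tree_bracket angular_bracket)
  have FA_grafting: "?FA (grafting F) = angular_grafting (?FA F)" for F :: "'x lforest"
    using angular_bracket[of "map tree_letter F"] by (simp add: grafting_def bracket_def)
  \<comment> \<open>Closure of the sets of forests under grafting is transported from closure of the words
    under bracketing.\<close>
  have closed_spaced: "grafting F \<in> leaf_spaced X" if "F \<in> leaf_spaced X" for F
  proof -
    have "leaf_spaced X = map letter_tree ` (S_words X \<inter> R_words X)"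
      using bij_map_letter_tree(1)[OF map_letter_tree_in_leaf_spaced, of X]
      by (simp add: bij_betw_def)
    with that obtain w where "w \<in> S_words X \<inter> R_words X" "F = map letter_tree w" by blast
    then show ?thesis
      by (simp add: map_letter_tree_in_leaf_spaced bracket_closed flip: map_letter_tree_bracket)
  qed
  have closed_ladder: "angular_grafting a \<in> ladder_free X" if "a \<in> ladder_free X" for a
  proof -
    have "ladder_free X = angular ` (S_words X \<inter> R_words X)"
      using A0 by (simp add: bij_betw_def)
    with that obtain w where "w \<in> S_words X \<inter> R_words X" "a = angular w" by blast
    then show ?thesis
      by (simp add: angular_in_ladder_free bracket_closed flip: angular_bracket)
  qed

  have prod: "product_compatible (M_words X) (@) (Motzkin X) (@) word_path"
    "product_compatible (S_words X) (@) (peak_free X) (@) word_path"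
    "product_compatible (R_words X) (@) (valley_free X) (@) word_path"
    "product_compatible (S_words X \<inter> R_words X) (@) (peak_free X \<inter> valley_free X) (@) word_path"
    by (auto simp: product_compatible_def word_path_in_Motzkin word_path_in_peak_free
        word_path_in_valley_free simp flip: word_path_simps(3))
  have prod_LF: "product_compatible (peak_free X) (@) (leaf_forests X) (@) ?LF"
    "product_compatible (peak_free X \<inter> valley_free X) (@) (leaf_spaced X) (@) ?LF"
    using bij_betwE[OF LF(1)] bij_betwE[OF LF(2)]
    by (auto simp: product_compatible_def LF_append simp del: o_apply simp flip: LF_append)
  have prod_id: "product_compatible A (@) B (@) id" if "A \<subseteq> B" for A B :: "'a list set"
    using that by (auto simp: product_compatible_def)

  have oper: "operator_compatible (M_words X) bracket (Motzkin X) raising word_path"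
    "operator_compatible (S_words X) bracket (peak_free X) raising word_path"
    "operator_compatible (R_words X) bracket (valley_free X) raising word_path"
    "operator_compatible (S_words X \<inter> R_words X) bracket (peak_free X \<inter> valley_free X) raising
       word_path"
    by (rule operator_compatibleI;
        auto simp: word_path_bracket bracket_closed word_path_in_Motzkin word_path_in_peak_free
          word_path_in_valley_free)+
  have oper_forest: "operator_compatible (peak_free X) raising (leaf_forests X) grafting ?LF"
    "operator_compatible (valley_free X) raising (angular_forests X) angular_grafting ?VA"
    "operator_compatible (peak_free X \<inter> valley_free X) raising (leaf_spaced X) grafting ?LF"
    "operator_compatible (peak_free X \<inter> valley_free X) raising (ladder_free X)
       angular_grafting ?VA"
    using raising_closed[of _ X] subsetD[OF sub(3)] subsetD[OF sub(4)]
      bij_betwE[OF LF(1)] bij_betwE[OF LF(2)] bij_betwE[OF VA(1)] bij_betwE[OF VA(2)]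
    by (rule_tac [!] operator_compatibleI)
      (simp_all add: LF_raising VA_raising del: o_apply)
  have oper_FA: "operator_compatible (leaf_spaced X) grafting (ladder_free X) angular_grafting ?FA"
    using bij_betwE[OF FA] closed_spaced FA_grafting by (intro operator_compatibleI) blast+
  have oper_id: "operator_compatible A f B f id" if "A \<subseteq> B" "\<And>a. a \<in> A \<Longrightarrow> f a \<in> A"
    for A B :: "'a set" and f
    using that by (auto simp: operator_compatible_def)

  \<comment> \<open>Since the inverse of \<open>word_path\<close> is one and the same function on all sets of paths, every
    restriction in the diagram is given by the formula of the map that it restricts.\<close>
  show ?thesis
    by (rule exI[of _ word_path], rule exI[of _ word_path], rule exI[of _ word_path],
        rule exI[of _ ?LF], rule exI[of _ ?VA], rule exI[of _ word_path],
        rule exI[of _ ?LF], rule exI[of _ ?VA], rule exI[of _ ?FA],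
        intro conjI ballI bij_word_path W LF VA FA sub Int_lower1 Int_lower2 prod prod_LF
          prod_id oper oper_forest oper_FA oper_id;
        auto simp: o_def raising_closed closed_spaced closed_ladder bracket_closed)
qed

end
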